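(* Let $N\ge 2$, $\sigma>0$, $\tilde W\in\mathbb{R}^{N^2\times N^2}$ and $c\in\mathbb{R}^{N^2}$. Let $\tilde f_0(x)=x^T\tilde W x+c^Tx+\text{const}$ on $\mathbb{R}^{N^2}$, and let $\tilde f_1,\dots,\tilde f_{N-1}$, with $\tilde f_l:\mathbb{R}^{(N-l)^2}\to\mathbb{R}$, be the cost functions produced from $\tilde f_0$ by the successive dimension reductions of the time-triggered dimension reduction algorithm (described in the context). If $\tilde f_0$ is $\sigma$-strongly convex, then $\tilde f_l$ is $\sigma$-strongly convex for all $l\in\{1,\dots,N-1\}$.
   Context: Strong convexity: a differentiable function $f$ is $\sigma$-strongly convex ($\sigma>0$) on a domain $\mathcal{D}$ if $f(y)\ge f(x)+\nabla f(x)^T(y-x)+\frac{\sigma}{2}\|y-x\|_2^2$ for all $x,y\in\mathcal{D}$. Here the domain of $\tilde f_l$ is $\mathbb{R}^{(N-l)^2}$. Notation: $\mathrm{vec}$ is vectorization of a matrix and $\mathrm{vec}^{-1}$ its inverse (to a square matrix). $\mathbb{DS}_n$ is the set of $n\times n$ doubly stochastic matrices (entrywise nonnegative, all row and column sums equal to $1$), and $\mathrm{Proj}_{\mathbb{DS}_n}$ is the Euclidean (Frobenius norm) projection onto $\mathbb{DS}_n$, applied to vectors through $\mathrm{vec}^{-1}$. Dimension reductions of the time-triggered dimension reduction algorithm: set $\tilde W(0)=\tilde W\in\mathbb{R}^{N^2\times N^2}$, $c(0)=c$, and start from an arbitrary $x\in\mathbb{R}^{N^2}$. At stage $l=0,1,\dots,N-2$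 the cost is $\tilde f_l(x)=x^T\tilde W(l)x+c(l)^Tx+\text{const}$ with $\tilde W(l)\in\mathbb{R}^{(N-l)^2\times(N-l)^2}$. The algorithm performs a finite prescribed number of projected gradient steps $x\leftarrow\mathrm{Proj}_{\mathbb{DS}_{N-l}}(x-\alpha_k\nabla\tilde f_l(x))$ with step sizes $\alpha_k>0$. It then takes the position $(r,c)$ of a largest entry of the current iterate $X=\mathrm{vec}^{-1}(x)\in\mathbb{R}^{(N-l)\times(N-l)}$, and deletes row $r$ and column $c$ from $X$ (the result is the starting point of the next stage). Let $I\subset\{1,\dots,(N-l)^2\}$ be the set of the $2(N-l)-1$ indices in $x=\mathrm{vec}(X)$ of the entries of $X$ lying in row $r$ or in column $c$. Then $\tilde W(l+1)\in\mathbb{R}^{(N-l-1)^2\times(N-l-1)^2}$ is obtained from $\tilde W(l)$ by deleting all rows and all columns with index in $I$, and $c(l+1)$ is obtained from $c(l)$ by deleting the entries with index in $I$. Finally, $\tilde f_{l+1}(x)=x^T\tilde W(l+1)x+c(l+1)^Tx+\text{const}$ on $\mathbb{R}^{(N-l-1)^2}$. *)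

theory Defs
  imports
    Complex_Main
    "Jordan_Normal_Form.Matrix"
    "Jordan_Normal_Form.Determinant"
    "Jordan_Normal_Form.DL_Submatrix"
begin

text \<open>
  The dimension changes from stage to stage, so \<open>\<real>\<^sup>d\<close> is the carrier
  \<^term>\<open>carrier_vec d :: real vec set\<close>. These vectors are not a type-class instance of a normed
  space; Euclidean norm and gradient are therefore defined here. All indices start at 0.
\<close>

definition eucl_norm :: "real vec \<Rightarrow> real" where
  "eucl_norm v = sqrt (v \<bullet> v)"

text \<open>Frechet differentiability on \<open>\<real>\<^sup>d\<close> at \<open>x\<close>, with derivative \<open>h \<mapsto> g\<^sup>T h\<close>.\<close>

definition has_gradient :: "nat \<Rightarrow> (real vec \<Rightarrow> real) \<Rightarrow> real vec \<Rightarrow> real vec \<Rightarrow> bool" where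
  "has_gradient d f x g \<longleftrightarrow>
     g \<in> carrier_vec d \<and>
     (\<forall>e>0. \<exists>\<delta>>0. \<forall>y\<in>carrier_vec d. eucl_norm (y - x) < \<delta> \<longrightarrow>
        \<bar>f y - f x - g \<bullet> (y - x)\<bar> \<le> e * eucl_norm (y - x))"

definition gradient :: "nat \<Rightarrow> (real vec \<Rightarrow> real) \<Rightarrow> real vec \<Rightarrow> real vec" where
  "gradient d f x = (THE g. has_gradient d f x g)"

definition strongly_convex :: "nat \<Rightarrow> real \<Rightarrow> (real vec \<Rightarrow> real) \<Rightarrow> bool" where
  "strongly_convex d \<sigma> f \<longleftrightarrow>
     \<sigma> > 0 \<and>
     (\<forall>x\<in>carrier_vec d. \<exists>g. has_gradient d f x g) \<and>
     (\<forall>x\<in>carrier_vec d. \<forall>y\<in>carrier_vec d.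
        f y \<ge> f x + gradient d f x \<bullet> (y - x) + \<sigma> / 2 * (eucl_norm (y - x))\<^sup>2)"

text \<open>
  Column-stacking: entry \<open>(i, j)\<close> of an \<open>m \<times> m\<close> matrix becomes entry \<open>i + j * m\<close>.
\<close>

definition vectorize :: "'a mat \<Rightarrow> 'a vec" where
  "vectorize X =
     vec (dim_row X * dim_col X) (\<lambda>k. X $$ (k mod dim_row X, k div dim_row X))"

definition unvectorize :: "nat \<Rightarrow> 'a vec \<Rightarrow> 'a mat" where
  "unvectorize m v = mat m m (\<lambda>(i, j). v $ (i + j * m))"

definition doubly_stochastic :: "nat \<Rightarrow> real mat set" where
  "doubly_stochastic m =
     {X \<in> carrier_mat m m.
        (\<forall>i<m. \<forall>j<m. 0 \<le> X $$ (i, j)) \<and>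
        (\<forall>i<m. (\<Sum>j<m. X $$ (i, j)) = 1) \<and>
        (\<forall>j<m. (\<Sum>i<m. X $$ (i, j)) = 1)}"

definition frobenius_norm :: "real mat \<Rightarrow> real" where
  "frobenius_norm X = sqrt (\<Sum>i<dim_row X. \<Sum>j<dim_col X. (X $$ (i, j))\<^sup>2)"

text \<open>The minimiser exists and is unique because the set is nonempty, compact and convex.\<close>

definition proj_DS :: "nat \<Rightarrow> real vec \<Rightarrow> real vec" where
  "proj_DS m v =
     vectorize (arg_min_on (\<lambda>Y. frobenius_norm (Y - unvectorize m v)) (doubly_stochastic m))"

definition quadratic_cost :: "real mat \<Rightarrow> real vec \<Rightarrow> real \<Rightarrow> real vec \<Rightarrow> real" where
  "quadratic_cost W c \<kappa> x = x \<bullet> (W *\<^sub>v x) + c \<bullet> x + \<kappa>"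

primrec projected_gradient ::
  "nat \<Rightarrow> (real vec \<Rightarrow> real) \<Rightarrow> (nat \<Rightarrow> real) \<Rightarrow> real vec \<Rightarrow> nat \<Rightarrow> real vec" where
  "projected_gradient m f \<alpha> x 0 = x"
| "projected_gradient m f \<alpha> x (Suc k) =
     (let y = projected_gradient m f \<alpha> x k
      in proj_DS m (y - \<alpha> k \<cdot>\<^sub>v gradient (m\<^sup>2) f y))"

definition largest_entry_at :: "real mat \<Rightarrow> nat \<Rightarrow> nat \<Rightarrow> bool" where
  "largest_entry_at X r s \<longleftrightarrow>
     r < dim_row X \<and> s < dim_col X \<and>
     (\<forall>i<dim_row X. \<forall>j<dim_col X. X $$ (i, j) \<le> X $$ (r, s))"

text \<open>Indices in \<open>vectorize X\<close> of the entries of \<open>X\<close> lying in row \<open>r\<close> or in column \<open>s\<close>.\<close>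

definition cross_indices :: "nat \<Rightarrow> nat \<Rightarrow> nat \<Rightarrow> nat set" where
  "cross_indices m r s = {i + j * m | i j. i < m \<and> j < m \<and> (i = r \<or> j = s)}"

text \<open>
  Both operations below keep the remaining entries in their original order; the index sets
  handed to \<^const>\<open>submatrix\<close> and \<^const>\<open>pick\<close> are the indices that are kept.
\<close>

definition delete_rows_cols :: "'a mat \<Rightarrow> nat set \<Rightarrow> 'a mat" where
  "delete_rows_cols A I = submatrix A (- I) (- I)"

definition delete_entries :: "'a vec \<Rightarrow> nat set \<Rightarrow> 'a vec" where
  "delete_entries v I = vec (card {i. i < dim_vec v \<and> i \<notin> I}) (\<lambda>i. v $ pick (- I) i)"

text \<open>
  A run of the algorithm: \<open>x l\<close> is the starting point of stage \<open>l\<close>, and \<open>W l\<close>, \<open>c l\<close>, \<open>\<kappa> l\<close>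
  are the data of its cost. Stage \<open>l\<close> makes \<open>K l\<close> projected gradient steps with step sizes
  \<open>\<alpha> l 0, \<alpha> l 1, \<dots>\<close>. It is a predicate since the largest entry need not be unique.
  The additive constants \<open>\<kappa> l\<close> are arbitrary.
\<close>

definition time_triggered_run ::
  "nat \<Rightarrow> (nat \<Rightarrow> nat) \<Rightarrow> (nat \<Rightarrow> nat \<Rightarrow> real) \<Rightarrow> real mat \<Rightarrow> real vec \<Rightarrow>
   (nat \<Rightarrow> real vec) \<Rightarrow> (nat \<Rightarrow> real mat) \<Rightarrow> (nat \<Rightarrow> real vec) \<Rightarrow> (nat \<Rightarrow> real) \<Rightarrow> bool" where
  "time_triggered_run N K \<alpha> W\<^sub>0 c\<^sub>0 x W c \<kappa> \<longleftrightarrow>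
     W 0 = W\<^sub>0 \<and> c 0 = c\<^sub>0 \<and> x 0 \<in> carrier_vec (N\<^sup>2) \<and>
     (\<forall>l. l + 2 \<le> N \<longrightarrow>
        (\<forall>k<K l. \<alpha> l k > 0) \<and>
        (let m = N - l;
             f = quadratic_cost (W l) (c l) (\<kappa> l);
             X = unvectorize m (projected_gradient m f (\<alpha> l) (x l) (K l))
         in \<exists>r s. largest_entry_at X r s \<and>
              x (Suc l) = vectorize (mat_delete X r s) \<and>
              W (Suc l) = delete_rows_cols (W l) (cross_indices m r s) \<and>
              c (Suc l) = delete_entries (c l) (cross_indices m r s)))"

end

(*
  The Hessian criterion: a quadratic cost on R^d is \<sigma>-strongly convex iff h . W h \<ge> \<sigma>/2 (h . h)
  for all h. Deleting rows and columns of W with the same indices restricts this form to the vectors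
  supported on the remaining indices, where the bound is inherited. In particular it does not matter
  which row and column of X are deleted.
*)
theory Submission
  imports Defs
begin

section \<open>Gradients\<close>

lemma scalar_prod_self_eq_sum:
  fixes v :: "real vec"
  shows "v \<bullet> v = (\<Sum>i<dim_vec v. (v $ i)\<^sup>2)"
  by (simp add: scalar_prod_def power2_eq_square lessThan_atLeast0)

lemma eucl_norm_nonneg: "eucl_norm v \<ge> 0"
  by (simp add: eucl_norm_def scalar_prod_self_eq_sum sum_nonneg)

lemma eucl_norm_square: "(eucl_norm v)\<^sup>2 = v \<bullet> v"
  by (simp add: eucl_norm_def scalar_prod_self_eq_sum sum_nonneg)

lemma eucl_norm_smult: "eucl_norm (t \<cdot>\<^sub>v v) = \<bar>t\<bar> * eucl_norm v"
  by (simp add: eucl_norm_def real_sqrt_mult flip: mult.assoc)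

lemma eucl_norm_eq_0:
  assumes "v \<in> carrier_vec d" and "eucl_norm v = 0"
  shows "v = 0\<^sub>v d"
proof -
  have "(\<Sum>i<dim_vec v. (v $ i)\<^sup>2) = 0"
    using assms(2) eucl_norm_square[of v] by (simp add: scalar_prod_self_eq_sum)
  then have "\<forall>i<dim_vec v. v $ i = 0"
    by (subst (asm) sum_nonneg_eq_0_iff) auto
  then show ?thesis
    using assms(1) by (intro eq_vecI) auto
qed

lemma abs_index_le_eucl_norm:
  assumes "i < dim_vec v"
  shows "\<bar>v $ i\<bar> \<le> eucl_norm v"
proof -
  have "(v $ i)\<^sup>2 \<le> (\<Sum>i<dim_vec v. (v $ i)\<^sup>2)"
    using assms by (intro member_le_sum) auto
  then show ?thesis
    unfolding eucl_norm_def scalar_prod_self_eq_sum by (intro real_le_rsqrt) simp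
qed

text \<open>This makes the description in \<open>gradient\<close> well defined. Two linear
  approximations at x are compared along the direction u = g - g': at x + t u they differ by t times
  the square of n = \<open>eucl_norm u\<close>, which is too much for two errors of first order when
  t is small.\<close>

lemma has_gradient_unique:
  assumes x: "x \<in> carrier_vec d"
    and g: "has_gradient d f x g" and g': "has_gradient d f x g'"
  shows "g = g'"
proof (rule ccontr)
  assume neq: "g \<noteq> g'"
  have gc: "g \<in> carrier_vec d" "g' \<in> carrier_vec d"
    using g g' by (auto simp: has_gradient_def)
  define u where "u = g - g'"
  define n where "n = eucl_norm u"
  have u: "u \<in> carrier_vec d"
    using gc by (simp add: u_def)
  have "n \<noteq> 0"
  proof
    assume "n = 0"
    then have "g - g' = 0\<^sub>v d"
      using eucl_norm_eq_0 u by (simp add: n_def u_def)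
    then have "g $ i - g' $ i = 0" if "i < d" for i
      using that gc by (metis carrier_vecD index_minus_vec(1) index_zero_vec(1))
    then show False
      using neq gc by (metis carrier_vecD eq_iff_diff_eq_0 eq_vecI)
  qed
  then have n: "n > 0"
    using eucl_norm_nonneg[of u] by (simp add: n_def)
  \<comment> \<open>The tolerance n / 4 makes the two errors together at most half of the gap t *
    n^2.\<close>
  have approx: "\<exists>\<delta>>0. \<forall>y\<in>carrier_vec d. eucl_norm (y - x) < \<delta> \<longrightarrow>
      \<bar>f y - f x - g \<bullet> (y - x)\<bar> \<le> n / 4 * eucl_norm (y - x)"
    if "has_gradient d f x g" for g
  proof -
    have "n / 4 > 0"
      using n by simp
    with that show ?thesis
      unfolding has_gradient_def by blast
  qed
  obtain \<delta>\<^sub>1 where d1: "\<delta>\<^sub>1 > 0" "\<forall>y\<in>carrier_vec d. eucl_norm (y - x) < \<delta>\<^sub>1 \<longrightarrow>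
      \<bar>f y - f x - g \<bullet> (y - x)\<bar> \<le> n / 4 * eucl_norm (y - x)"
    using approx[OF g] by blast
  obtain \<delta>\<^sub>2 where d2: "\<delta>\<^sub>2 > 0" "\<forall>y\<in>carrier_vec d. eucl_norm (y - x) < \<delta>\<^sub>2 \<longrightarrow>
      \<bar>f y - f x - g' \<bullet> (y - x)\<bar> \<le> n / 4 * eucl_norm (y - x)"
    using approx[OF g'] by blast
  \<comment> \<open>The step t u has length t * n, half of the smaller radius, so both estimates
    apply at y.\<close>
  define t where "t = min \<delta>\<^sub>1 \<delta>\<^sub>2 / (2 * n)"
  have t: "t > 0"
    using d1 d2 n by (simp add: t_def)
  define y where "y = x + t \<cdot>\<^sub>v u"
  have y: "y \<in> carrier_vec d"
    using x u by (simp add: y_def)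
  have yx: "y - x = t \<cdot>\<^sub>v u"
    using x u unfolding y_def by (intro eq_vecI) auto
  have norm: "eucl_norm (y - x) = t * n"
    using t by (simp add: yx eucl_norm_smult n_def)
  have "t * n = min \<delta>\<^sub>1 \<delta>\<^sub>2 / 2"
    using n by (simp add: t_def)
  then have small: "t * n < \<delta>\<^sub>1" "t * n < \<delta>\<^sub>2"
    using d1(1) d2(1) by auto
  have "\<bar>f y - f x - g \<bullet> (y - x)\<bar> \<le> n / 4 * (t * n)"
    "\<bar>f y - f x - g' \<bullet> (y - x)\<bar> \<le> n / 4 * (t * n)"
    using d1(2) d2(2) y norm small by auto
  then have "g \<bullet> (y - x) - g' \<bullet> (y - x) \<le> n / 2 * (t * n)"
    by linarith
  moreover have "g \<bullet> (y - x) - g' \<bullet> (y - x) = t * n\<^sup>2"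
  proof -
    have "g \<bullet> (y - x) - g' \<bullet> (y - x) = u \<bullet> (t \<cdot>\<^sub>v u)"
      using gc u by (simp add: yx u_def minus_scalar_prod_distrib right_diff_distrib)
    also have "\<dots> = t * n\<^sup>2"
      using u by (simp add: n_def eucl_norm_square)
    finally show ?thesis .
  qed
  ultimately show False
    using n t by (simp add: power2_eq_square)
qed

lemma gradient_eqI:
  assumes "x \<in> carrier_vec d" and "has_gradient d f x g"
  shows "gradient d f x = g"
  unfolding gradient_def using assms has_gradient_unique by blast

section \<open>Quadratic costs\<close>

lemma quadratic_form_eq_sum:
  assumes "W \<in> carrier_mat d d" and "h \<in> carrier_vec d"
  shows "h \<bullet> (W *\<^sub>v h) = (\<Sum>i<d. \<Sum>j<d. h $ i * W $$ (i, j) * h $ j)"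
  using assms
  by (simp add: scalar_prod_def lessThan_atLeast0 sum_distrib_left mult.assoc)

text \<open>A crude constant suffices: any bound that is quadratic in the norm makes the form
  negligible to first order.\<close>

lemma abs_quadratic_form_le:
  fixes W :: "real mat"
  assumes "W \<in> carrier_mat d d" and "h \<in> carrier_vec d"
  shows "\<bar>h \<bullet> (W *\<^sub>v h)\<bar> \<le> (\<Sum>i<d. \<Sum>j<d. \<bar>W $$ (i, j)\<bar>) * (eucl_norm h)\<^sup>2"
proof -
  have "\<bar>h \<bullet> (W *\<^sub>v h)\<bar> \<le> (\<Sum>i<d. \<Sum>j<d. \<bar>h $ i * W $$ (i, j) * h $ j\<bar>)"
    unfolding quadratic_form_eq_sum[OF assms]
    by (intro order_trans[OF sum_abs] sum_mono sum_abs)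
  also have "\<dots> \<le> (\<Sum>i<d. \<Sum>j<d. \<bar>W $$ (i, j)\<bar> * (eucl_norm h)\<^sup>2)"
  proof (intro sum_mono)
    fix i j assume "i \<in> {..<d}" "j \<in> {..<d}"
    then have "\<bar>h $ i\<bar> * \<bar>h $ j\<bar> \<le> eucl_norm h * eucl_norm h"
      using assms by (intro mult_mono abs_index_le_eucl_norm eucl_norm_nonneg) auto
    then have "\<bar>W $$ (i, j)\<bar> * (\<bar>h $ i\<bar> * \<bar>h $ j\<bar>) \<le> \<bar>W $$ (i, j)\<bar> * (eucl_norm h)\<^sup>2"
      unfolding power2_eq_square by (rule mult_left_mono) simp
    then show "\<bar>h $ i * W $$ (i, j) * h $ j\<bar> \<le> \<bar>W $$ (i, j)\<bar> * (eucl_norm h)\<^sup>2"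
      by (simp add: abs_mult mult_ac)
  qed
  finally show ?thesis
    by (simp add: sum_distrib_right)
qed

text \<open>W is not assumed symmetric, so the two mixed terms stay separate: one is commuted, the
  other is moved to x by the transpose. The vector paired with h is the gradient at x.\<close>

lemma quadratic_cost_add:
  assumes W: "W \<in> carrier_mat d d" and c: "c \<in> carrier_vec d"
    and x: "x \<in> carrier_vec d" and h: "h \<in> carrier_vec d"
  shows "quadratic_cost W c \<kappa> (x + h) =
    quadratic_cost W c \<kappa> x + (W *\<^sub>v x + transpose_mat W *\<^sub>v x + c) \<bullet> h + h \<bullet> (W *\<^sub>v h)"
proof -
  have Wx: "W *\<^sub>v x \<in> carrier_vec d" and Wh: "W *\<^sub>v h \<in> carrier_vec d"
    and Wt: "transpose_mat W *\<^sub>v x \<in> carrier_vec d"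
    using W x h by auto
  have "(x + h) \<bullet> (W *\<^sub>v (x + h)) = (x + h) \<bullet> (W *\<^sub>v x + W *\<^sub>v h)"
    using W x h by (simp add: mult_add_distrib_mat_vec)
  also have "\<dots> = x \<bullet> (W *\<^sub>v x) + x \<bullet> (W *\<^sub>v h) + (h \<bullet> (W *\<^sub>v x) + h \<bullet> (W *\<^sub>v h))"
    using x h Wx Wh by (simp add: add_scalar_prod_distrib[of _ d] scalar_prod_add_distrib[of _ d])
  also have "h \<bullet> (W *\<^sub>v x) = (W *\<^sub>v x) \<bullet> h"
    using h Wx by (rule comm_scalar_prod)
  also have "x \<bullet> (W *\<^sub>v h) = (transpose_mat W *\<^sub>v x) \<bullet> h"
    using transpose_vec_mult_scalar[OF W h x] h x W comm_scalar_prod[of h d] by simp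
  finally have 1: "(x + h) \<bullet> (W *\<^sub>v (x + h)) =
    x \<bullet> (W *\<^sub>v x) + (transpose_mat W *\<^sub>v x) \<bullet> h + ((W *\<^sub>v x) \<bullet> h + h \<bullet> (W *\<^sub>v h))" .
  have 2: "c \<bullet> (x + h) = c \<bullet> x + c \<bullet> h"
    using c x h by (rule scalar_prod_add_distrib)
  have 3: "(W *\<^sub>v x + transpose_mat W *\<^sub>v x + c) \<bullet> h =
    (W *\<^sub>v x) \<bullet> h + (transpose_mat W *\<^sub>v x) \<bullet> h + c \<bullet> h"
    using Wx Wt c h by (simp add: add_scalar_prod_distrib[of _ d])
  show ?thesis
    unfolding quadratic_cost_def 1 2 3 by simp
qed

text \<open>The expansion ends at second order, hence is exact. No factor 1/2 appears because the
  Hessian is W plus its transpose.\<close>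

lemma quadratic_cost_taylor:
  assumes W: "W \<in> carrier_mat d d" and c: "c \<in> carrier_vec d"
    and x: "x \<in> carrier_vec d" and y: "y \<in> carrier_vec d"
  shows "quadratic_cost W c \<kappa> y = quadratic_cost W c \<kappa> x +
    (W *\<^sub>v x + transpose_mat W *\<^sub>v x + c) \<bullet> (y - x) + (y - x) \<bullet> (W *\<^sub>v (y - x))"
proof -
  have "x + (y - x) = y"
    using x y by (intro eq_vecI) auto
  then show ?thesis
    using quadratic_cost_add[OF W c x, of "y - x"] x y by simp
qed

lemma has_gradient_quadratic_cost:
  assumes W: "W \<in> carrier_mat d d" and c: "c \<in> carrier_vec d" and x: "x \<in> carrier_vec d"
  shows "has_gradient d (quadratic_cost W c \<kappa>) x (W *\<^sub>v x + transpose_mat W *\<^sub>v x + c)"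
  unfolding has_gradient_def
proof (intro conjI allI impI)
  show "W *\<^sub>v x + transpose_mat W *\<^sub>v x + c \<in> carrier_vec d"
    using assms by auto
next
  fix e :: real assume e: "e > 0"
  define M where "M = (\<Sum>i<d. \<Sum>j<d. \<bar>W $$ (i, j)\<bar>)"
  have M: "M \<ge> 0"
    unfolding M_def by (intro sum_nonneg) simp
  \<comment> \<open>The radius has M + 1 in the denominator, which is positive also when W vanishes
    and M = 0.\<close>
  have "\<bar>quadratic_cost W c \<kappa> y - quadratic_cost W c \<kappa> x -
      (W *\<^sub>v x + transpose_mat W *\<^sub>v x + c) \<bullet> (y - x)\<bar> \<le> e * eucl_norm (y - x)"
    if y: "y \<in> carrier_vec d" and small: "eucl_norm (y - x) < e / (M + 1)" for y
  proof -
    have "\<bar>quadratic_cost W c \<kappa> y - quadratic_cost W c \<kappa> x -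
        (W *\<^sub>v x + transpose_mat W *\<^sub>v x + c) \<bullet> (y - x)\<bar> = \<bar>(y - x) \<bullet> (W *\<^sub>v (y - x))\<bar>"
      using quadratic_cost_taylor[OF W c x y] by simp
    also have "\<dots> \<le> M * (eucl_norm (y - x))\<^sup>2"
      unfolding M_def using W x y by (intro abs_quadratic_form_le) auto
    also have "\<dots> = M * eucl_norm (y - x) * eucl_norm (y - x)"
      by (simp add: power2_eq_square)
    also have "\<dots> \<le> e * eucl_norm (y - x)"
    proof (rule mult_right_mono[OF _ eucl_norm_nonneg])
      have "(M + 1) * eucl_norm (y - x) \<le> e"
        using small M by (simp add: field_simps)
      then show "M * eucl_norm (y - x) \<le> e"
        using eucl_norm_nonneg[of "y - x"] by (simp add: algebra_simps)
    qed
    finally show ?thesis .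
  qed
  moreover have "e / (M + 1) > 0"
    using e M by simp
  ultimately show "\<exists>\<delta>>0. \<forall>y\<in>carrier_vec d. eucl_norm (y - x) < \<delta> \<longrightarrow>
      \<bar>quadratic_cost W c \<kappa> y - quadratic_cost W c \<kappa> x -
        (W *\<^sub>v x + transpose_mat W *\<^sub>v x + c) \<bullet> (y - x)\<bar> \<le> e * eucl_norm (y - x)"
    by blast
qed

text \<open>Once the true gradient is inserted, the terms of order zero and one cancel against the
  exact expansion. What is left of the inequality depends on x and y through y - x alone.\<close>

lemma strongly_convex_quadratic_cost_iff:
  assumes W: "W \<in> carrier_mat d d" and c: "c \<in> carrier_vec d"
  shows "strongly_convex d \<sigma> (quadratic_cost W c \<kappa>) \<longleftrightarrow>
    \<sigma> > 0 \<and> (\<forall>h\<in>carrier_vec d. \<sigma> / 2 * (h \<bullet> h) \<le> h \<bullet> (W *\<^sub>v h))"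
proof -
  let ?f = "quadratic_cost W c \<kappa>"
  have ineq: "?f y \<ge> ?f x + gradient d ?f x \<bullet> (y - x) + \<sigma> / 2 * (eucl_norm (y - x))\<^sup>2
    \<longleftrightarrow> \<sigma> / 2 * ((y - x) \<bullet> (y - x)) \<le> (y - x) \<bullet> (W *\<^sub>v (y - x))"
    if "x \<in> carrier_vec d" "y \<in> carrier_vec d" for x y
    unfolding quadratic_cost_taylor[OF W c that]
      gradient_eqI[OF that(1) has_gradient_quadratic_cost[OF W c that(1)]] eucl_norm_square
    by linarith
  show ?thesis
  proof
    assume sc: "strongly_convex d \<sigma> ?f"
    have "\<sigma> / 2 * (h \<bullet> h) \<le> h \<bullet> (W *\<^sub>v h)" if h: "h \<in> carrier_vec d" for h
    proof -
      \<comment> \<open>The pair x = 0, y = h realises an arbitrary h as a difference.\<close>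
      have "\<sigma> / 2 * ((h - 0\<^sub>v d) \<bullet> (h - 0\<^sub>v d)) \<le> (h - 0\<^sub>v d) \<bullet> (W *\<^sub>v (h - 0\<^sub>v d))"
        unfolding ineq[OF zero_carrier_vec h, symmetric]
        using sc h zero_carrier_vec unfolding strongly_convex_def by blast
      then show ?thesis
        using h by simp
    qed
    then show "\<sigma> > 0 \<and> (\<forall>h\<in>carrier_vec d. \<sigma> / 2 * (h \<bullet> h) \<le> h \<bullet> (W *\<^sub>v h))"
      using sc by (simp add: strongly_convex_def)
  next
    assume pos: "\<sigma> > 0 \<and> (\<forall>h\<in>carrier_vec d. \<sigma> / 2 * (h \<bullet> h) \<le> h \<bullet> (W *\<^sub>v h))"
    show "strongly_convex d \<sigma> ?f"
      unfolding strongly_convex_def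
    proof (intro conjI ballI)
      show "\<exists>g. has_gradient d ?f x g" if "x \<in> carrier_vec d" for x
        using has_gradient_quadratic_cost[OF W c that] by blast
      show "?f x + gradient d ?f x \<bullet> (y - x) + \<sigma> / 2 * (eucl_norm (y - x))\<^sup>2 \<le> ?f y"
        if "x \<in> carrier_vec d" "y \<in> carrier_vec d" for x y
        unfolding ineq[OF that] using pos that by simp
    qed (use pos in simp)
  qed
qed

section \<open>Principal submatrices\<close>

lemma pick_less_mem:
  assumes "i < card {k. k < d \<and> k \<in> S}"
  shows "pick S i < d" and "pick S i \<in> S"
  using pick_in_set_le[OF assms] pick_reduce_set[OF assms] by auto

text \<open>Counting the elements of S below an index inverts the enumeration \<open>pick S\<close>.
  S may be infinite, as \<open>- I\<close> is below, so the count is taken in its part below d,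
  where the i-th element is the same.\<close>

lemma card_less_pick:
  assumes "i < card {k. k < d \<and> k \<in> S}"
  shows "card {a \<in> S. a < pick S i} = i"
proof -
  have "{a \<in> S. a < pick S i} = {a \<in> {k. k < d \<and> k \<in> S}. a < pick {k. k < d \<and> k \<in> S} i}"
    using pick_less_mem(1)[OF assms] pick_reduce_set[OF assms] by auto
  then show ?thesis
    using card_pick_le[OF assms] by simp
qed

text \<open>The counting function gives injectivity; surjectivity follows because the image is a
  subset of the same finite cardinality.\<close>

lemma bij_betw_pick:
  "bij_betw (pick S) {..<card {k. k < d \<and> k \<in> S}} {k. k < d \<and> k \<in> S}"
proof -
  have inj: "inj_on (pick S) {..<card {k. k < d \<and> k \<in> S}}"
    by (rule inj_on_inverseI[where g = "\<lambda>k. card {a \<in> S. a < k}"]) (auto simp: card_less_pick)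
  moreover have "pick S ` {..<card {k. k < d \<and> k \<in> S}} = {k. k < d \<and> k \<in> S}"
    using pick_less_mem by (intro card_subset_eq) (auto simp: card_image[OF inj])
  ultimately show ?thesis
    by (simp add: bij_betw_def)
qed

lemma sum_pick:
  fixes g :: "nat \<Rightarrow> 'a :: comm_monoid_add"
  assumes "\<And>k. k < d \<Longrightarrow> k \<notin> S \<Longrightarrow> g k = 0"
  shows "(\<Sum>i<card {k. k < d \<and> k \<in> S}. g (pick S i)) = (\<Sum>k<d. g k)"
proof -
  have "(\<Sum>i<card {k. k < d \<and> k \<in> S}. g (pick S i)) = (\<Sum>k | k < d \<and> k \<in> S. g k)"
    by (rule sum.reindex_bij_betw[OF bij_betw_pick])
  also have "\<dots> = (\<Sum>k<d. g k)"
    using assms by (intro sum.mono_neutral_left) auto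
  finally show ?thesis .
qed

lemma submatrix_carrier:
  assumes "W \<in> carrier_mat d d"
  shows "submatrix W S S \<in> carrier_mat (card {k. k < d \<and> k \<in> S}) (card {k. k < d \<and> k \<in> S})"
  using assms by (auto simp: dim_submatrix)

text \<open>The witness u is h extended by zero to the deleted indices, where all terms of both sums
  vanish.\<close>

lemma submatrix_quadratic_form:
  fixes W :: "real mat"
  assumes W: "W \<in> carrier_mat d d" and h: "h \<in> carrier_vec (card {k. k < d \<and> k \<in> S})"
  obtains u where "u \<in> carrier_vec d" and "u \<bullet> u = h \<bullet> h"
    and "u \<bullet> (W *\<^sub>v u) = h \<bullet> (submatrix W S S *\<^sub>v h)"
proof -
  define n where "n = card {k. k < d \<and> k \<in> S}"
  \<comment> \<open>The cardinality is the rank of k among the kept indices, that is, the position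
    in h of the entry that goes to k.\<close>
  define u where "u = vec d (\<lambda>k. if k \<in> S then h $ card {a \<in> S. a < k} else 0)"
  have u: "u \<in> carrier_vec d"
    by (simp add: u_def)
  have u_pick: "u $ pick S i = h $ i" if "i < n" for i
    using that pick_less_mem[of i d S] card_less_pick[of i d S] by (simp add: u_def n_def)
  have u_0: "u $ k = 0" if "k < d" "k \<notin> S" for k
    using that by (simp add: u_def)
  have "u \<bullet> u = (\<Sum>i<n. (u $ pick S i)\<^sup>2)"
    unfolding n_def using u u_0 by (subst sum_pick) (auto simp: scalar_prod_self_eq_sum)
  also have "\<dots> = h \<bullet> h"
    using h u_pick by (simp add: scalar_prod_self_eq_sum n_def)
  finally have norm: "u \<bullet> u = h \<bullet> h" .
  have "u \<bullet> (W *\<^sub>v u) = (\<Sum>k<d. \<Sum>l<d. u $ k * W $$ (k, l) * u $ l)"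
    by (rule quadratic_form_eq_sum[OF W u])
  also have "\<dots> = (\<Sum>i<n. \<Sum>l<d. u $ pick S i * W $$ (pick S i, l) * u $ l)"
    unfolding n_def using u_0 by (subst sum_pick) auto
  also have "\<dots> = (\<Sum>i<n. \<Sum>j<n. u $ pick S i * W $$ (pick S i, pick S j) * u $ pick S j)"
    \<comment> \<open>The inner sum is contracted for each fixed i, with \<open>sum_pick\<close>
      read from right to left and its summand given explicitly.\<close>
    unfolding n_def using u_0
    by (intro sum.cong refl
        sum_pick[symmetric, where g = "\<lambda>l. u $ pick S i * W $$ (pick S i, l) * u $ l" for i]) auto
  also have "\<dots> = (\<Sum>i<n. \<Sum>j<n. h $ i * submatrix W S S $$ (i, j) * h $ j)"
    using W by (intro sum.cong refl) (simp add: u_pick submatrix_index n_def)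
  also have "\<dots> = h \<bullet> (submatrix W S S *\<^sub>v h)"
    unfolding n_def by (rule quadratic_form_eq_sum[OF submatrix_carrier[OF W] h, symmetric])
  finally show thesis
    using that u norm by blast
qed

text \<open>The dimensions are returned along with the convexity so that the lemma can be applied
  stage after stage. The constant \<kappa>' is independent of \<kappa> because a run may change the
  additive constant at each stage.\<close>

lemma strongly_convex_delete:
  assumes W: "W \<in> carrier_mat d d" and c: "c \<in> carrier_vec d"
    and n: "n = card {k. k < d \<and> k \<notin> I}"
    and sc: "strongly_convex d \<sigma> (quadratic_cost W c \<kappa>)"
  shows "delete_rows_cols W I \<in> carrier_mat n n" and "delete_entries c I \<in> carrier_vec n"
    and "strongly_convex n \<sigma> (quadratic_cost (delete_rows_cols W I) (delete_entries c I) \<kappa>')"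
proof -
  show W': "delete_rows_cols W I \<in> carrier_mat n n"
    using submatrix_carrier[OF W, of "- I"] by (simp add: delete_rows_cols_def n)
  show c': "delete_entries c I \<in> carrier_vec n"
    using c by (simp add: delete_entries_def n)
  have pos: "\<sigma> / 2 * (u \<bullet> u) \<le> u \<bullet> (W *\<^sub>v u)" if "u \<in> carrier_vec d" for u
    using sc that by (simp add: strongly_convex_quadratic_cost_iff[OF W c])
  have "\<sigma> / 2 * (h \<bullet> h) \<le> h \<bullet> (delete_rows_cols W I *\<^sub>v h)" if "h \<in> carrier_vec n" for h
  proof -
    have "h \<in> carrier_vec (card {k. k < d \<and> k \<in> - I})"
      using that by (simp add: n)
    from submatrix_quadratic_form[OF W this] pos show ?thesis
      unfolding delete_rows_cols_def by metis
  qed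
  moreover have "\<sigma> > 0"
    using sc by (simp add: strongly_convex_def)
  ultimately show "strongly_convex n \<sigma> (quadratic_cost (delete_rows_cols W I) (delete_entries c I) \<kappa>')"
    by (simp add: strongly_convex_quadratic_cost_iff[OF W' c'])
qed

section \<open>The number of indices left after the deletion of a row and a column\<close>

lemma card_not_cross_indices:
  assumes r: "r < m" and s: "s < m"
  shows "card {k. k < m\<^sup>2 \<and> k \<notin> cross_indices m r s} = (m - 1)\<^sup>2"
proof -
  \<comment> \<open>A code i + j * m with i < m determines i and j as remainder and quotient, so
    membership can be read off from the pair.\<close>
  have mem: "i + j * m \<in> cross_indices m r s \<longleftrightarrow> i = r \<or> j = s" if "i < m" "j < m" for i j
  proof
    assume "i + j * m \<in> cross_indices m r s"
    then obtain i' j' where *: "i + j * m = i' + j' * m" "i' < m" "i' = r \<or> j' = s"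
      by (auto simp: cross_indices_def)
    have "i = i'"
      using arg_cong[OF *(1), of "\<lambda>k. k mod m"] that *(2) by simp
    moreover have "j = j'"
      using arg_cong[OF *(1), of "\<lambda>k. k div m"] that *(2) by simp
    ultimately show "i = r \<or> j = s"
      using *(3) by simp
  qed (use that in \<open>auto simp: cross_indices_def\<close>)
  \<comment> \<open>The surviving indices are the codes of a grid with one row and one column
    removed, which has m - 1 choices for each coordinate.\<close>
  have "bij_betw (\<lambda>(i, j). i + j * m) (({..<m} - {r}) \<times> ({..<m} - {s}))
    {k. k < m\<^sup>2 \<and> k \<notin> cross_indices m r s}"
  proof (rule bij_betw_byWitness[where f' = "\<lambda>k. (k mod m, k div m)"])
    show "(\<lambda>(i, j). i + j * m) ` (({..<m} - {r}) \<times> ({..<m} - {s}))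
      \<subseteq> {k. k < m\<^sup>2 \<and> k \<notin> cross_indices m r s}"
    proof (rule image_subsetI)
      fix p assume "p \<in> ({..<m} - {r}) \<times> ({..<m} - {s})"
      then obtain i j where p: "p = (i, j)" and ij: "i < m" "i \<noteq> r" "j < m" "j \<noteq> s"
        by auto
      have "i + j * m < Suc j * m"
        using ij by simp
      also have "\<dots> \<le> m * m"
        using ij by (intro mult_right_mono) auto
      finally show "(case p of (i, j) \<Rightarrow> i + j * m) \<in> {k. k < m\<^sup>2 \<and> k \<notin> cross_indices m r s}"
        using ij by (simp add: p mem power2_eq_square)
    qed
  next
    show "(\<lambda>k. (k mod m, k div m)) ` {k. k < m\<^sup>2 \<and> k \<notin> cross_indices m r s}
      \<subseteq> ({..<m} - {r}) \<times> ({..<m} - {s})"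
    proof (rule image_subsetI)
      fix k assume "k \<in> {k. k < m\<^sup>2 \<and> k \<notin> cross_indices m r s}"
      then have k: "k < m * m" "k \<notin> cross_indices m r s"
        by (auto simp: power2_eq_square)
      have lt: "k mod m < m" "k div m < m"
        using r k(1) by (auto simp: less_mult_imp_div_less)
      then show "(k mod m, k div m) \<in> ({..<m} - {r}) \<times> ({..<m} - {s})"
        using mem[OF lt] k(2) by simp
    qed
  qed auto
  then have "card {k. k < m\<^sup>2 \<and> k \<notin> cross_indices m r s}
    = card (({..<m} - {r}) \<times> ({..<m} - {s}))"
    by (simp add: bij_betw_same_card)
  also have "\<dots> = (m - 1)\<^sup>2"
    using r s by (simp add: card_cartesian_product power2_eq_square)
  finally show ?thesis .
qed

section \<open>Induction over the stages of a run\<close>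

theorem theorem4:
  fixes N :: nat and \<sigma> :: real and W\<^sub>0 :: "real mat" and c\<^sub>0 :: "real vec"
    and K :: "nat \<Rightarrow> nat" and \<alpha> :: "nat \<Rightarrow> nat \<Rightarrow> real"
    and x :: "nat \<Rightarrow> real vec" and W :: "nat \<Rightarrow> real mat" and c :: "nat \<Rightarrow> real vec"
    and \<kappa> :: "nat \<Rightarrow> real"
  assumes "N \<ge> 2" and "\<sigma> > 0"
    and "W\<^sub>0 \<in> carrier_mat (N\<^sup>2) (N\<^sup>2)" and "c\<^sub>0 \<in> carrier_vec (N\<^sup>2)"
    and "time_triggered_run N K \<alpha> W\<^sub>0 c\<^sub>0 x W c \<kappa>"
    and "strongly_convex (N\<^sup>2) \<sigma> (quadratic_cost W\<^sub>0 c\<^sub>0 (\<kappa> 0))"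
  shows "\<forall>l\<in>{1..N - 1}.
           strongly_convex ((N - l)\<^sup>2) \<sigma> (quadratic_cost (W l) (c l) (\<kappa> l))"
proof -
  \<comment> \<open>The dimensions of W l and c l are part of the induction claim, since
    \<open>strongly_convex_delete\<close> asks for them. Stage 0 is included as the base
    case.\<close>
  have "W l \<in> carrier_mat ((N - l)\<^sup>2) ((N - l)\<^sup>2) \<and> c l \<in> carrier_vec ((N - l)\<^sup>2) \<and>
      strongly_convex ((N - l)\<^sup>2) \<sigma> (quadratic_cost (W l) (c l) (\<kappa> l))"
    if "l < N" for l
    using that
  proof (induction l)
    case 0
    then show ?case
      using assms by (simp add: time_triggered_run_def)
  next
    case (Suc l)
    then have IH: "W l \<in> carrier_mat ((N - l)\<^sup>2) ((N - l)\<^sup>2)" "c l \<in> carrier_vec ((N - l)\<^sup>2)"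
      "strongly_convex ((N - l)\<^sup>2) \<sigma> (quadratic_cost (W l) (c l) (\<kappa> l))"
      by auto
    \<comment> \<open>A run prescribes the passage from l to Suc l exactly under this bound, which
      is Suc l < N.\<close>
    have "l + 2 \<le> N"
      using Suc.prems by simp
    then obtain X r s where X: "X = unvectorize (N - l) (projected_gradient (N - l)
          (quadratic_cost (W l) (c l) (\<kappa> l)) (\<alpha> l) (x l) (K l))"
      and largest: "largest_entry_at X r s"
      and W: "W (Suc l) = delete_rows_cols (W l) (cross_indices (N - l) r s)"
      and c: "c (Suc l) = delete_entries (c l) (cross_indices (N - l) r s)"
      using assms(5) unfolding time_triggered_run_def Let_def by blast
    \<comment> \<open>The chosen entry is a position of X, and \<open>unvectorize\<close> gives X
      the dimension N - l.\<close>
    have "r < N - l" "s < N - l"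
      using largest by (auto simp: largest_entry_at_def X unvectorize_def)
    \<comment> \<open>The count (N - l - 1)^2 of kept indices is the dimension that the next stage
      expects.\<close>
    then have "(N - Suc l)\<^sup>2 = card {k. k < (N - l)\<^sup>2 \<and> k \<notin> cross_indices (N - l) r s}"
      by (simp add: card_not_cross_indices)
    from strongly_convex_delete[OF IH(1,2) this IH(3)] show ?case
      by (simp add: W c)
  qed
  then show ?thesis
    using assms(1) by auto
qed

end
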